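(* Let $(M,\varphi,\xi,\eta,g,\varepsilon,a,b,c)$ be an Einstein-like $(\varepsilon)$-almost paracontact metric manifold admitting an $\eta$-Ricci soliton $(g,\xi,\lambda,\mu)$. Then: (i) $\varepsilon(a+\lambda)+c+\mu=0$; (ii) $\xi$ is a geodesic vector field, i.e. $\nabla_\xi\xi=0$; (iii) $(\nabla_\xi\varphi)\xi=0$ and $\nabla_\xi\eta=0$; (iv) $(\nabla_\xi S)(Y,Z)=b\,g((\nabla_\xi\varphi)Y,Z)$ for all vector fields $Y,Z$, and $\nabla_\xi Q=b\,\nabla_\xi\varphi$. Moreover, if the manifold is $(\varepsilon)$-para Sasakian, then $\nabla_\xi S=0$ and $\nabla_\xi Q=0$.
   Context: An $(\varepsilon)$-almost paracontact metric structure $(\varphi,\xi,\eta,g,\varepsilon)$ on an $n$-dimensional manifold $M$ consists of a $(1,1)$-tensor field $\varphi$, a vector field $\xi$, a $1$-form $\eta$, a pseudo-Riemannian metric $g$ and $\varepsilon\in\{1,-1\}$ with $\varphi^2=I-\eta\otimes\xi$, $\eta(\xi)=1$, $\varphi\xi=0$, $\eta\circ\varphi=0$ and $g(\varphi X,\varphi Y)=g(X,Y)-\varepsilon\eta(X)\eta(Y)$ for all vector fields $X,Y$. (Consequently $g(X,\xi)=\varepsilon\eta(X)$ and $g(\varphi X,Y)=g(X,\varphi Y)$.) $\nabla$ is the Levi-Civita connection of $g$, $S$ the Ricci tensor, and $Q$ the Ricci operator defined by $g(QX,Y)=S(X,Y)$. The structure is $(\varepsilon)$-para Sasakian if $(\nabla_X\varphi)Y=-g(\varphi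 X,\varphi Y)\xi-\varepsilon\eta(Y)\varphi^2X$ for all $X,Y$. $(M,\varphi,\xi,\eta,g,\varepsilon,a,b,c)$ is Einstein-like if $a,b,c$ are real constants with $S(X,Y)=a\,g(X,Y)+b\,g(\varphi X,Y)+c\,\eta(X)\eta(Y)$ for all vector fields $X,Y$. $(g,\xi,\lambda,\mu)$, with $\lambda,\mu$ real constants, is an $\eta$-Ricci soliton if $\frac12\mathcal{L}_\xi g+S+\lambda g+\mu\,\eta\otimes\eta=0$. *)

theory Defs
  imports "HOL-Analysis.Analysis" "HOL-Library.Function_Algebras"
begin

section \<open>Smooth manifolds\<close>

text \<open>For open \<open>U\<close>, the iterated directional derivatives up to order \<open>k\<close> exist and are continuous.\<close>

primrec C_k_on :: "nat \<Rightarrow> ('a::euclidean_space \<Rightarrow> 'b::real_normed_vector) \<Rightarrow> 'a set \<Rightarrow> bool" where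
  "C_k_on 0 f U = continuous_on U f"
| "C_k_on (Suc k) f U =
    ((\<forall>x\<in>U. f differentiable (at x)) \<and> (\<forall>v. C_k_on k (\<lambda>x. frechet_derivative f (at x) v) U))"

definition smooth_on :: "('a::euclidean_space \<Rightarrow> 'b::real_normed_vector) \<Rightarrow> 'a set \<Rightarrow> bool" where
  "smooth_on f U \<longleftrightarrow> (\<forall>k. C_k_on k f U)"

text \<open>
  The points of the manifold form a whole type \<open>'m\<close>, whose class provides the (Hausdorff, second
  countable) topology.  A chart is a pair of a domain and a coordinate map that is only meaningful
  on this domain; the dimension of the manifold is \<open>DIM('e)\<close>.
\<close>

type_synonym ('m, 'e) chart = "'m set \<times> ('m \<Rightarrow> 'e)"

definition smooth_atlas ::
    "('m::{t2_space,second_countable_topology}, 'e::euclidean_space) chart set \<Rightarrow> bool" where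
  "smooth_atlas A \<longleftrightarrow>
     (\<forall>(U, x)\<in>A. open U \<and> open (x ` U) \<and> homeomorphism U (x ` U) x (inv_into U x)) \<and>
     (\<Union>(U, x)\<in>A. U) = UNIV \<and>
     (\<forall>(U, x)\<in>A. \<forall>(V, y)\<in>A. smooth_on (y \<circ> inv_into U x) (x ` (U \<inter> V)))"

definition smooth :: "('m, 'e::euclidean_space) chart set \<Rightarrow> ('m \<Rightarrow> real) \<Rightarrow> bool" where
  "smooth A f \<longleftrightarrow> (\<forall>(U, x)\<in>A. smooth_on (f \<circ> inv_into U x) (x ` U))"


section \<open>Vector fields and tensor fields\<close>

text \<open>
  Tangent vectors at \<open>p\<close> are the derivations at \<open>p\<close> of the algebra of smooth functions.  As HOL
  functions are total, they are required to vanish on all other functions, so that two tangent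
  vectors are equal as soon as they agree on smooth functions.
\<close>

type_synonym 'm tangent = "('m \<Rightarrow> real) \<Rightarrow> real"
type_synonym 'm vfield = "'m \<Rightarrow> 'm tangent"

definition tangent_space :: "('m, 'e::euclidean_space) chart set \<Rightarrow> 'm \<Rightarrow> 'm tangent set" where
  "tangent_space A p = {v.
     (\<forall>f. \<not> smooth A f \<longrightarrow> v f = 0) \<and>
     (\<forall>f h. smooth A f \<longrightarrow> smooth A h \<longrightarrow> v (\<lambda>q. f q + h q) = v f + v h) \<and>
     (\<forall>c f. smooth A f \<longrightarrow> v (\<lambda>q. c * f q) = c * v f) \<and>
     (\<forall>f h. smooth A f \<longrightarrow> smooth A h \<longrightarrow> v (\<lambda>q. f q * h q) = f p * v h + h p * v f)}"

definition scale_tangent :: "real \<Rightarrow> 'm tangent \<Rightarrow> 'm tangent" where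
  "scale_tangent r v = (\<lambda>f. r * v f)"

interpretation tangent: vector_space scale_tangent
  by unfold_locales (auto simp: scale_tangent_def fun_eq_iff algebra_simps)

definition apply_field :: "'m vfield \<Rightarrow> ('m \<Rightarrow> real) \<Rightarrow> ('m \<Rightarrow> real)" where
  "apply_field X f = (\<lambda>p. X p f)"

definition vector_field :: "('m, 'e::euclidean_space) chart set \<Rightarrow> 'm vfield \<Rightarrow> bool" where
  "vector_field A X \<longleftrightarrow>
     (\<forall>p. X p \<in> tangent_space A p) \<and> (\<forall>f. smooth A f \<longrightarrow> smooth A (apply_field X f))"

definition scale_field :: "('m \<Rightarrow> real) \<Rightarrow> 'm vfield \<Rightarrow> 'm vfield" (infixr "\<cdot>" 75) where
  "f \<cdot> X = (\<lambda>p. scale_tangent (f p) (X p))"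

definition lie_bracket :: "'m vfield \<Rightarrow> 'm vfield \<Rightarrow> 'm vfield" where
  "lie_bracket X Y = (\<lambda>p f. X p (apply_field Y f) - Y p (apply_field X f))"

text \<open>
  Tensor fields are maps on vector fields that are multilinear over the smooth functions.
  Their behaviour on arguments that are not vector fields is irrelevant.
\<close>

definition one_form :: "('m, 'e::euclidean_space) chart set \<Rightarrow> ('m vfield \<Rightarrow> 'm \<Rightarrow> real) \<Rightarrow> bool" where
  "one_form A \<omega> \<longleftrightarrow>
     (\<forall>X. vector_field A X \<longrightarrow> smooth A (\<omega> X)) \<and>
     (\<forall>X Y. vector_field A X \<longrightarrow> vector_field A Y \<longrightarrow> \<omega> (X + Y) = \<omega> X + \<omega> Y) \<and>
     (\<forall>f X. smooth A f \<longrightarrow> vector_field A X \<longrightarrow> \<omega> (f \<cdot> X) = f * \<omega> X)"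

definition endo_field :: "('m, 'e::euclidean_space) chart set \<Rightarrow> ('m vfield \<Rightarrow> 'm vfield) \<Rightarrow> bool" where
  "endo_field A T \<longleftrightarrow>
     (\<forall>X. vector_field A X \<longrightarrow> vector_field A (T X)) \<and>
     (\<forall>X Y. vector_field A X \<longrightarrow> vector_field A Y \<longrightarrow> T (X + Y) = T X + T Y) \<and>
     (\<forall>f X. smooth A f \<longrightarrow> vector_field A X \<longrightarrow> T (f \<cdot> X) = f \<cdot> T X)"

definition bilinear_form_field ::
    "('m, 'e::euclidean_space) chart set \<Rightarrow> ('m vfield \<Rightarrow> 'm vfield \<Rightarrow> 'm \<Rightarrow> real) \<Rightarrow> bool" where
  "bilinear_form_field A B \<longleftrightarrow>
     (\<forall>X. vector_field A X \<longrightarrow> one_form A (B X) \<and> one_form A (\<lambda>Y. B Y X))"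

text \<open>
  Nondegeneracy is required at every point: since every tangent vector at \<open>p\<close> is the value \<open>X p\<close> of
  some vector field \<open>X\<close>, the last clause says that the bilinear form induced by \<open>g\<close> on the tangent
  space at \<open>p\<close> is nondegenerate.
\<close>

definition pseudo_riemannian_metric ::
    "('m, 'e::euclidean_space) chart set \<Rightarrow> ('m vfield \<Rightarrow> 'm vfield \<Rightarrow> 'm \<Rightarrow> real) \<Rightarrow> bool" where
  "pseudo_riemannian_metric A g \<longleftrightarrow>
     bilinear_form_field A g \<and>
     (\<forall>X Y. vector_field A X \<longrightarrow> vector_field A Y \<longrightarrow> g X Y = g Y X) \<and>
     (\<forall>p X. vector_field A X \<longrightarrow> (\<forall>Y. vector_field A Y \<longrightarrow> g X Y p = 0) \<longrightarrow> X p = 0)"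


section \<open>Connections, curvature and derivatives of tensor fields\<close>

definition affine_connection ::
    "('m, 'e::euclidean_space) chart set \<Rightarrow> ('m vfield \<Rightarrow> 'm vfield \<Rightarrow> 'm vfield) \<Rightarrow> bool" where
  "affine_connection A D \<longleftrightarrow>
     (\<forall>Y. vector_field A Y \<longrightarrow> endo_field A (\<lambda>X. D X Y)) \<and>
     (\<forall>X Y Z. vector_field A X \<longrightarrow> vector_field A Y \<longrightarrow> vector_field A Z \<longrightarrow>
        D X (Y + Z) = D X Y + D X Z) \<and>
     (\<forall>f X Y. smooth A f \<longrightarrow> vector_field A X \<longrightarrow> vector_field A Y \<longrightarrow>
        D X (f \<cdot> Y) = apply_field X f \<cdot> Y + f \<cdot> D X Y)"

definition levi_civita ::
    "('m, 'e::euclidean_space) chart set \<Rightarrow> ('m vfield \<Rightarrow> 'm vfield \<Rightarrow> 'm \<Rightarrow> real) \<Rightarrow>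
     ('m vfield \<Rightarrow> 'm vfield \<Rightarrow> 'm vfield) \<Rightarrow> bool" where
  "levi_civita A g D \<longleftrightarrow>
     affine_connection A D \<and>
     (\<forall>X Y. vector_field A X \<longrightarrow> vector_field A Y \<longrightarrow> D X Y - D Y X = lie_bracket X Y) \<and>
     (\<forall>X Y Z. vector_field A X \<longrightarrow> vector_field A Y \<longrightarrow> vector_field A Z \<longrightarrow>
        apply_field X (g Y Z) = g (D X Y) Z + g Y (D X Z))"

definition curvature ::
    "('m vfield \<Rightarrow> 'm vfield \<Rightarrow> 'm vfield) \<Rightarrow> 'm vfield \<Rightarrow> 'm vfield \<Rightarrow> 'm vfield \<Rightarrow> 'm vfield" where
  "curvature D X Y Z = D X (D Y Z) - D Y (D X Z) - D (lie_bracket X Y) Z"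

text \<open>
  The endomorphism of the tangent space at \<open>p\<close> induced by \<open>T\<close>: extend a tangent vector to a vector
  field, apply \<open>T\<close>, evaluate at \<open>p\<close>.  For \<open>T\<close> linear over the smooth functions the choice of the
  extension does not matter.
\<close>

definition endo_at ::
    "('m, 'e::euclidean_space) chart set \<Rightarrow> ('m vfield \<Rightarrow> 'm vfield) \<Rightarrow> 'm \<Rightarrow> 'm tangent \<Rightarrow> 'm tangent" where
  "endo_at A T p v = T (SOME X. vector_field A X \<and> X p = v) p"

definition tangent_basis :: "('m, 'e::euclidean_space) chart set \<Rightarrow> 'm \<Rightarrow> 'm tangent set \<Rightarrow> bool" where
  "tangent_basis A p B \<longleftrightarrow> tangent.independent B \<and> tangent.span B = tangent_space A p"

text \<open>
  Trace of an endomorphism of the tangent space at \<open>p\<close>, i.e. the sum of the diagonal entries of its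
  matrix in a basis; it does not depend on the basis.
\<close>

definition tangent_trace ::
    "('m, 'e::euclidean_space) chart set \<Rightarrow> 'm \<Rightarrow> ('m tangent \<Rightarrow> 'm tangent) \<Rightarrow> real" where
  "tangent_trace A p L =
     (let B = SOME B. tangent_basis A p B in \<Sum>b\<in>B. tangent.representation B (L b) b)"

definition ricci ::
    "('m, 'e::euclidean_space) chart set \<Rightarrow> ('m vfield \<Rightarrow> 'm vfield \<Rightarrow> 'm vfield) \<Rightarrow>
     'm vfield \<Rightarrow> 'm vfield \<Rightarrow> 'm \<Rightarrow> real" where
  "ricci A D Y Z = (\<lambda>p. tangent_trace A p (endo_at A (\<lambda>X. curvature D X Y Z) p))"

definition ricci_operator ::
    "('m, 'e::euclidean_space) chart set \<Rightarrow> ('m vfield \<Rightarrow> 'm vfield \<Rightarrow> 'm \<Rightarrow> real) \<Rightarrow>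
     ('m vfield \<Rightarrow> 'm vfield \<Rightarrow> 'm vfield) \<Rightarrow> ('m vfield \<Rightarrow> 'm vfield) \<Rightarrow> bool" where
  "ricci_operator A g D Q \<longleftrightarrow>
     endo_field A Q \<and>
     (\<forall>X Y. vector_field A X \<longrightarrow> vector_field A Y \<longrightarrow> g (Q X) Y = ricci A D X Y)"

definition cov_deriv_form ::
    "('m vfield \<Rightarrow> 'm vfield \<Rightarrow> 'm vfield) \<Rightarrow> 'm vfield \<Rightarrow> ('m vfield \<Rightarrow> 'm \<Rightarrow> real) \<Rightarrow>
     'm vfield \<Rightarrow> 'm \<Rightarrow> real" where
  "cov_deriv_form D X \<omega> Y = apply_field X (\<omega> Y) - \<omega> (D X Y)"

definition cov_deriv_endo ::
    "('m vfield \<Rightarrow> 'm vfield \<Rightarrow> 'm vfield) \<Rightarrow> 'm vfield \<Rightarrow> ('m vfield \<Rightarrow> 'm vfield) \<Rightarrow>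
     'm vfield \<Rightarrow> 'm vfield" where
  "cov_deriv_endo D X T Y = D X (T Y) - T (D X Y)"

definition cov_deriv_bilinear ::
    "('m vfield \<Rightarrow> 'm vfield \<Rightarrow> 'm vfield) \<Rightarrow> 'm vfield \<Rightarrow> ('m vfield \<Rightarrow> 'm vfield \<Rightarrow> 'm \<Rightarrow> real) \<Rightarrow>
     'm vfield \<Rightarrow> 'm vfield \<Rightarrow> 'm \<Rightarrow> real" where
  "cov_deriv_bilinear D X B Y Z = apply_field X (B Y Z) - B (D X Y) Z - B Y (D X Z)"

definition lie_deriv_bilinear ::
    "'m vfield \<Rightarrow> ('m vfield \<Rightarrow> 'm vfield \<Rightarrow> 'm \<Rightarrow> real) \<Rightarrow> 'm vfield \<Rightarrow> 'm vfield \<Rightarrow> 'm \<Rightarrow> real" where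
  "lie_deriv_bilinear X B Y Z =
     apply_field X (B Y Z) - B (lie_bracket X Y) Z - B Y (lie_bracket X Z)"


section \<open>Almost paracontact metric structures and solitons\<close>

definition almost_paracontact_metric ::
    "('m, 'e::euclidean_space) chart set \<Rightarrow> ('m vfield \<Rightarrow> 'm vfield) \<Rightarrow> 'm vfield \<Rightarrow>
     ('m vfield \<Rightarrow> 'm \<Rightarrow> real) \<Rightarrow> ('m vfield \<Rightarrow> 'm vfield \<Rightarrow> 'm \<Rightarrow> real) \<Rightarrow> real \<Rightarrow> bool" where
  "almost_paracontact_metric A \<phi> \<xi> \<eta> g \<epsilon> \<longleftrightarrow>
     endo_field A \<phi> \<and> vector_field A \<xi> \<and> one_form A \<eta> \<and> pseudo_riemannian_metric A g \<and>
     \<epsilon> \<in> {1, -1} \<and>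
     (\<forall>X. vector_field A X \<longrightarrow> \<phi> (\<phi> X) = X - \<eta> X \<cdot> \<xi>) \<and>
     (\<forall>p. \<eta> \<xi> p = 1) \<and>
     \<phi> \<xi> = 0 \<and>
     (\<forall>X. vector_field A X \<longrightarrow> \<eta> (\<phi> X) = 0) \<and>
     (\<forall>X Y. vector_field A X \<longrightarrow> vector_field A Y \<longrightarrow>
        (\<forall>p. g (\<phi> X) (\<phi> Y) p = g X Y p - \<epsilon> * \<eta> X p * \<eta> Y p))"

definition para_sasakian ::
    "('m, 'e::euclidean_space) chart set \<Rightarrow> ('m vfield \<Rightarrow> 'm vfield) \<Rightarrow> 'm vfield \<Rightarrow>
     ('m vfield \<Rightarrow> 'm \<Rightarrow> real) \<Rightarrow> ('m vfield \<Rightarrow> 'm vfield \<Rightarrow> 'm \<Rightarrow> real) \<Rightarrow> real \<Rightarrow>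
     ('m vfield \<Rightarrow> 'm vfield \<Rightarrow> 'm vfield) \<Rightarrow> bool" where
  "para_sasakian A \<phi> \<xi> \<eta> g \<epsilon> D \<longleftrightarrow>
     (\<forall>X Y. vector_field A X \<longrightarrow> vector_field A Y \<longrightarrow>
        cov_deriv_endo D X \<phi> Y =
          - (g (\<phi> X) (\<phi> Y) \<cdot> \<xi>) - (\<lambda>p. \<epsilon> * \<eta> Y p) \<cdot> \<phi> (\<phi> X))"

definition einstein_like ::
    "('m, 'e::euclidean_space) chart set \<Rightarrow> ('m vfield \<Rightarrow> 'm vfield) \<Rightarrow>
     ('m vfield \<Rightarrow> 'm \<Rightarrow> real) \<Rightarrow> ('m vfield \<Rightarrow> 'm vfield \<Rightarrow> 'm \<Rightarrow> real) \<Rightarrow>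
     ('m vfield \<Rightarrow> 'm vfield \<Rightarrow> 'm vfield) \<Rightarrow> real \<Rightarrow> real \<Rightarrow> real \<Rightarrow> bool" where
  "einstein_like A \<phi> \<eta> g D a b c \<longleftrightarrow>
     (\<forall>X Y. vector_field A X \<longrightarrow> vector_field A Y \<longrightarrow>
        (\<forall>p. ricci A D X Y p = a * g X Y p + b * g (\<phi> X) Y p + c * \<eta> X p * \<eta> Y p))"

definition eta_ricci_soliton ::
    "('m, 'e::euclidean_space) chart set \<Rightarrow> 'm vfield \<Rightarrow>
     ('m vfield \<Rightarrow> 'm \<Rightarrow> real) \<Rightarrow> ('m vfield \<Rightarrow> 'm vfield \<Rightarrow> 'm \<Rightarrow> real) \<Rightarrow>
     ('m vfield \<Rightarrow> 'm vfield \<Rightarrow> 'm vfield) \<Rightarrow> real \<Rightarrow> real \<Rightarrow> bool" where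
  "eta_ricci_soliton A \<xi> \<eta> g D lam \<mu> \<longleftrightarrow>
     (\<forall>X Y. vector_field A X \<longrightarrow> vector_field A Y \<longrightarrow>
        (\<forall>p. 1 / 2 * lie_deriv_bilinear \<xi> g X Y p + ricci A D X Y p
              + lam * g X Y p + \<mu> * \<eta> X p * \<eta> Y p = 0))"

end

theory Submission
  imports Defs
begin

text \<open>
  The Ricci tensor enters only through the Einstein-like condition, so no trace or curvature is
  ever computed.  Substituting that condition into the soliton equation and writing the Lie
  derivative of a metric with the Levi-Civita connection gives, for all vector fields \<open>X\<close> and \<open>Y\<close>,
  \<open>1/2 (g(\<nabla>\<^sub>X\<xi>,Y) + g(X,\<nabla>\<^sub>Y\<xi>)) + (a + \<lambda>) g(X,Y) + b g(\<phi>X,Y) + (c + \<mu>) \<eta>(X) \<eta>(Y) = 0\<close>.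
  Since \<open>g(\<xi>,\<xi>) = \<epsilon>\<close> is constant, \<open>g(\<nabla>\<^sub>X\<xi>,\<xi>) = 0\<close> for all \<open>X\<close>.  Hence \<open>X = Y = \<xi>\<close> yields the scalar
  relation, and then \<open>X = \<xi>\<close> alone leaves \<open>g(\<nabla>\<^sub>\<xi>\<xi>,Y) = 0\<close> for all \<open>Y\<close>, so that \<open>\<nabla>\<^sub>\<xi>\<xi> = 0\<close> by
  nondegeneracy (\<open>geodesic_of_soliton\<close>).

  As \<open>\<eta>\<close> is \<open>\<epsilon>\<close> times the metric dual of \<open>\<xi>\<close>, it is parallel along \<open>\<xi>\<close> too.  Differentiating
  \<open>S = a g + b g(\<phi>\<cdot>,\<cdot>) + c \<eta>\<otimes>\<eta>\<close> along \<open>\<xi>\<close>, the first and the last summand are therefore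
  parallel and only \<open>b g((\<nabla>\<^sub>\<xi>\<phi>)\<cdot>,\<cdot>)\<close> survives.  The statement about \<open>Q\<close> follows because
  lowering an index commutes with a metric connection.  In the para Sasakian case,
  \<open>\<nabla>\<^sub>\<xi>\<phi> = 0\<close> because each summand of the defining formula contains \<open>\<phi>\<xi> = 0\<close>.

  The analytic input is that the smooth functions form an algebra containing the constants:
  this is what allows the product rule to be used on the terms above and makes differences and
  multiples of vector fields vector fields again.
\<close>

section \<open>The algebra of smooth functions\<close>

text \<open>
  The derivatives in the recursion for \<open>C_k_on\<close> are known only on \<open>U\<close>; openness of \<open>U\<close> makes
  them depend only on the values there, and so lets one rewrite them in the induction step.
\<close>

lemma C_k_on_cong:
  assumes "open U" "\<And>x. x \<in> U \<Longrightarrow> f x = h x" "C_k_on k f U"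
  shows "C_k_on k h U"
  using assms(2,3)
proof (induction k arbitrary: f h)
  case 0
  then show ?case by (simp cong: continuous_on_cong)
next
  case (Suc k)
  have "h differentiable (at x)" if x: "x \<in> U" for x
  proof -
    obtain f' where "(f has_derivative f') (at x)"
      using Suc.prems(2) x by (auto simp: differentiable_def)
    then have "(h has_derivative f') (at x)"
      using has_derivative_transform_within_open[OF _ assms(1) x] Suc.prems(1) by blast
    then show ?thesis by (auto simp: differentiable_def)
  qed
  moreover have "C_k_on k (\<lambda>x. frechet_derivative h (at x) v) U" for v
  proof (rule Suc.IH)
    show "C_k_on k (\<lambda>x. frechet_derivative f (at x) v) U"
      using Suc.prems(2) by simp
    show "frechet_derivative f (at x) v = frechet_derivative h (at x) v" if x: "x \<in> U" for x
      using frechet_derivative_transform_within_open[OF _ assms(1) x, of f h] Suc.prems x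
      by simp
  qed
  ultimately show ?case by simp
qed

lemma C_k_on_SucD: "C_k_on (Suc k) f U \<Longrightarrow> C_k_on k f U"
proof (induction k arbitrary: f)
  case 0
  then show ?case
    by (simp add: continuous_at_imp_continuous_on differentiable_imp_continuous_within)
next
  case (Suc k)
  then show ?case by auto
qed

lemma C_k_on_const: "C_k_on k (\<lambda>x. c) U"
  by (induction k arbitrary: c) (auto simp: frechet_derivative_const)

lemma C_k_on_add:
  assumes "open U" "C_k_on k f U" "C_k_on k h U"
  shows "C_k_on k (\<lambda>x. f x + h x) U"
  using assms(2,3)
proof (induction k arbitrary: f h)
  case 0
  then show ?case by (simp add: continuous_on_add)
next
  case (Suc k)
  have "C_k_on k (\<lambda>x. frechet_derivative (\<lambda>x. f x + h x) (at x) v) U" for v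
  proof (rule C_k_on_cong[OF assms(1)])
    show "C_k_on k (\<lambda>x. frechet_derivative f (at x) v + frechet_derivative h (at x) v) U"
      using Suc by simp
    show "frechet_derivative f (at x) v + frechet_derivative h (at x) v
        = frechet_derivative (\<lambda>x. f x + h x) (at x) v" if "x \<in> U" for x
    proof -
      have "(f has_derivative frechet_derivative f (at x)) (at x)"
        "(h has_derivative frechet_derivative h (at x)) (at x)"
        using Suc.prems that by (simp_all flip: frechet_derivative_works)
      from frechet_derivative_at[OF has_derivative_add[OF this]] show ?thesis by (rule fun_cong)
    qed
  qed
  then show ?case using Suc.prems by simp
qed

lemma C_k_on_mult:
  fixes f h :: "'a::euclidean_space \<Rightarrow> real"
  assumes "open U" "C_k_on k f U" "C_k_on k h U"
  shows "C_k_on k (\<lambda>x. f x * h x) U"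
  using assms(2,3)
proof (induction k arbitrary: f h)
  case 0
  then show ?case by (simp add: continuous_on_mult)
next
  case (Suc k)
  have "C_k_on k (\<lambda>x. frechet_derivative (\<lambda>x. f x * h x) (at x) v) U" for v
  proof (rule C_k_on_cong[OF assms(1)])
    show "C_k_on k (\<lambda>x. f x * frechet_derivative h (at x) v
                       + frechet_derivative f (at x) v * h x) U"
      using Suc by (intro C_k_on_add[OF assms(1)] Suc.IH) (auto intro: C_k_on_SucD)
    show "f x * frechet_derivative h (at x) v + frechet_derivative f (at x) v * h x
        = frechet_derivative (\<lambda>x. f x * h x) (at x) v" if "x \<in> U" for x
    proof -
      have "(f has_derivative frechet_derivative f (at x)) (at x)"
        "(h has_derivative frechet_derivative h (at x)) (at x)"
        using Suc.prems that by (simp_all flip: frechet_derivative_works)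
      from frechet_derivative_at[OF has_derivative_mult[OF this]] show ?thesis by (rule fun_cong)
    qed
  qed
  then show ?case using Suc.prems by simp
qed

lemma smooth_const: "smooth A (\<lambda>q. c)"
  by (auto simp: smooth_def smooth_on_def o_def C_k_on_const)

lemma smooth_add:
  assumes "smooth_atlas A" "smooth A f" "smooth A h"
  shows "smooth A (\<lambda>q. f q + h q)"
  unfolding smooth_def smooth_on_def o_def
proof safe
  fix U x k
  assume "(U, x) \<in> A"
  moreover from this have "open (x ` U)"
    using assms(1) unfolding smooth_atlas_def by blast
  ultimately show "C_k_on k (\<lambda>z. f (inv_into U x z) + h (inv_into U x z)) (x ` U)"
    using assms(2,3) unfolding smooth_def smooth_on_def o_def by (intro C_k_on_add) auto
qed

lemma smooth_mult:
  assumes "smooth_atlas A" "smooth A f" "smooth A h"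
  shows "smooth A (\<lambda>q. f q * h q)"
  unfolding smooth_def smooth_on_def o_def
proof safe
  fix U x k
  assume "(U, x) \<in> A"
  moreover from this have "open (x ` U)"
    using assms(1) unfolding smooth_atlas_def by blast
  ultimately show "C_k_on k (\<lambda>z. f (inv_into U x z) * h (inv_into U x z)) (x ` U)"
    using assms(2,3) unfolding smooth_def smooth_on_def o_def by (intro C_k_on_mult) auto
qed

section \<open>Vector fields as derivations and as a module\<close>

lemma field_add:
  assumes "vector_field A X" "smooth A f" "smooth A h"
  shows "X p (\<lambda>q. f q + h q) = X p f + X p h"
  using assms by (auto simp: vector_field_def tangent_space_def)

lemma field_cmult:
  assumes "vector_field A X" "smooth A f"
  shows "X p (\<lambda>q. c * f q) = c * X p f"
  using assms by (auto simp: vector_field_def tangent_space_def)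

lemma field_mult:
  assumes "vector_field A X" "smooth A f" "smooth A h"
  shows "X p (\<lambda>q. f q * h q) = f p * X p h + h p * X p f"
  using assms by (auto simp: vector_field_def tangent_space_def)

lemma field_const:
  assumes "vector_field A X"
  shows "X p (\<lambda>q. c) = 0"
proof -
  \<comment> \<open>The product rule for \<open>1 = 1 \<cdot> 1\<close> gives \<open>X 1 = 2 X 1\<close>.\<close>
  have "X p (\<lambda>q. 1) = 0"
    using field_mult[OF assms smooth_const[of A 1] smooth_const[of A 1], of p] by simp
  then show ?thesis
    using field_cmult[OF assms smooth_const[of A 1], of p c] by simp
qed

lemma vector_field_zero: "vector_field A 0"
  using smooth_const[of A 0]
  by (simp add: vector_field_def tangent_space_def apply_field_def zero_fun_def)

lemma vector_field_add:
  assumes "smooth_atlas A" "vector_field A X" "vector_field A Y"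
  shows "vector_field A (X + Y)"
  using assms smooth_add[OF assms(1)]
  by (auto simp: vector_field_def tangent_space_def apply_field_def algebra_simps)

lemma vector_field_scale:
  assumes "smooth_atlas A" "vector_field A X" "smooth A f"
  shows "vector_field A (f \<cdot> X)"
  using assms smooth_mult[OF assms(1)]
  by (auto simp: vector_field_def tangent_space_def apply_field_def scale_field_def
      scale_tangent_def algebra_simps)

lemma vector_field_diff:
  assumes "smooth_atlas A" "vector_field A X" "vector_field A Y"
  shows "vector_field A (X - Y)"
proof -
  have eq: "X - Y = X + (\<lambda>_. -1) \<cdot> Y"
    by (auto simp: fun_eq_iff scale_field_def scale_tangent_def)
  show ?thesis
    unfolding eq using assms by (intro vector_field_add vector_field_scale smooth_const)
qed

lemma one_form_smooth: "one_form A \<omega> \<Longrightarrow> vector_field A X \<Longrightarrow> smooth A (\<omega> X)"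
  by (simp add: one_form_def)

lemma one_form_zero:
  assumes "one_form A \<omega>"
  shows "\<omega> 0 = 0"
proof -
  have "\<omega> (0 + 0) = \<omega> 0 + \<omega> 0"
    using assms vector_field_zero unfolding one_form_def by blast
  then show ?thesis by simp
qed

lemma one_form_diff:
  assumes "smooth_atlas A" "one_form A \<omega>" "vector_field A X" "vector_field A Y"
  shows "\<omega> (X - Y) = \<omega> X - \<omega> Y"
proof -
  have "\<omega> ((X - Y) + Y) = \<omega> (X - Y) + \<omega> Y"
    using assms vector_field_diff[OF assms(1,3,4)] unfolding one_form_def by blast
  then show ?thesis by simp
qed

lemma endo_field_zero:
  assumes "endo_field A T"
  shows "T 0 = 0"
proof -
  have "T (0 + 0) = T 0 + T 0"
    using assms vector_field_zero unfolding endo_field_def by blast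
  then show ?thesis by simp
qed

section \<open>Metrics and their Levi-Civita connections\<close>

lemma metric_sym:
  assumes "pseudo_riemannian_metric A g" "vector_field A X" "vector_field A Y"
  shows "g X Y = g Y X"
  using assms(1)[unfolded pseudo_riemannian_metric_def, THEN conjunct2, THEN conjunct1] assms(2,3)
  by blast

lemma metric_nondegenerate:
  assumes "pseudo_riemannian_metric A g" "vector_field A X"
    and "\<And>Y p. vector_field A Y \<Longrightarrow> g X Y p = 0"
  shows "X = 0"
proof
  fix p
  have "X p = 0"
    using assms(3) by (rule assms(1)[unfolded pseudo_riemannian_metric_def, THEN conjunct2,
          THEN conjunct2, rule_format, OF assms(2)])
  then show "X p = 0 p" by simp
qed

lemma metric_one_form_left:
  assumes "pseudo_riemannian_metric A g" "vector_field A Y"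
  shows "one_form A (\<lambda>X. g X Y)"
  using assms(1)[unfolded pseudo_riemannian_metric_def, THEN conjunct1] assms(2)
  by (simp add: bilinear_form_field_def)

lemma metric_one_form_right:
  assumes "pseudo_riemannian_metric A g" "vector_field A X"
  shows "one_form A (g X)"
  using assms(1)[unfolded pseudo_riemannian_metric_def, THEN conjunct1] assms(2)
  by (simp add: bilinear_form_field_def)

lemma metric_smooth:
  assumes "pseudo_riemannian_metric A g" "vector_field A X" "vector_field A Y"
  shows "smooth A (g X Y)"
  by (rule one_form_smooth[OF metric_one_form_right[OF assms(1,2)] assms(3)])

lemma metric_eqI:
  assumes "smooth_atlas A" "pseudo_riemannian_metric A g" "vector_field A X" "vector_field A Y"
    and "\<And>Z p. vector_field A Z \<Longrightarrow> g X Z p = g Y Z p"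
  shows "X = Y"
proof -
  have "X - Y = 0"
    using assms one_form_diff[OF assms(1) metric_one_form_left[OF assms(2)] assms(3,4)]
    by (intro metric_nondegenerate[OF assms(2) vector_field_diff]) auto
  then show ?thesis by simp
qed

lemma levi_civita_vector_field:
  "levi_civita A g D \<Longrightarrow> vector_field A X \<Longrightarrow> vector_field A Y \<Longrightarrow> vector_field A (D X Y)"
  unfolding levi_civita_def affine_connection_def endo_field_def by blast

lemma levi_civita_metric:
  assumes "levi_civita A g D" "vector_field A X" "vector_field A Y" "vector_field A Z"
  shows "X p (g Y Z) = g (D X Y) Z p + g Y (D X Z) p"
proof -
  have "apply_field X (g Y Z) = g (D X Y) Z + g Y (D X Z)"
    using assms unfolding levi_civita_def by blast
  from fun_cong[OF this, of p] show ?thesis by (simp add: apply_field_def)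
qed

lemma levi_civita_zero:
  assumes "levi_civita A g D" "vector_field A X"
  shows "D X 0 = 0"
proof -
  have "D X (0 + 0) = D X 0 + D X 0"
    using assms vector_field_zero unfolding levi_civita_def affine_connection_def by blast
  then show ?thesis by simp
qed

text \<open>
  Metric compatibility expands the derivative of \<open>g Y Z\<close>, and vanishing torsion cancels its
  terms \<open>D X Y\<close> and \<open>D X Z\<close> against those of the Lie brackets.
\<close>

lemma lie_deriv_metric:
  assumes "smooth_atlas A" "pseudo_riemannian_metric A g" "levi_civita A g D"
    and "vector_field A X" "vector_field A Y" "vector_field A Z"
  shows "lie_deriv_bilinear X g Y Z p = g (D Y X) Z p + g Y (D Z X) p"
proof -
  note D = levi_civita_vector_field[OF assms(3)]
  have br: "lie_bracket X W = D X W - D W X" if "vector_field A W" for W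
    by (rule assms(3)[unfolded levi_civita_def, THEN conjunct2, THEN conjunct1, rule_format,
          OF assms(4) that, symmetric])
  have "g (lie_bracket X Y) Z = g (D X Y) Z - g (D Y X) Z"
    unfolding br[OF assms(5)]
    by (rule one_form_diff[OF assms(1) metric_one_form_left[OF assms(2,6)]
          D[OF assms(4,5)] D[OF assms(5,4)]])
  moreover have "g Y (lie_bracket X Z) = g Y (D X Z) - g Y (D Z X)"
    unfolding br[OF assms(6)]
    by (rule one_form_diff[OF assms(1) metric_one_form_right[OF assms(2,5)]
          D[OF assms(4,6)] D[OF assms(6,4)]])
  ultimately show ?thesis
    using levi_civita_metric[OF assms(3-6), of p]
    by (simp add: lie_deriv_bilinear_def apply_field_def)
qed

lemma levi_civita_constant_length:
  assumes "pseudo_riemannian_metric A g" "levi_civita A g D"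
    and "vector_field A X" "vector_field A Y" "\<And>p. g Y Y p = r"
  shows "g (D X Y) Y p = 0"
proof -
  have "g Y Y = (\<lambda>_. r)" using assms(5) by auto
  then have "X p (g Y Y) = 0" using field_const[OF assms(3)] by simp
  moreover have "g Y (D X Y) = g (D X Y) Y"
    by (rule metric_sym[OF assms(1,4) levi_civita_vector_field[OF assms(2-4)]])
  ultimately show ?thesis
    using levi_civita_metric[OF assms(2-4) assms(4), of p] by simp
qed

text \<open>Lowering an index commutes with the covariant derivative of a metric connection.\<close>

lemma cov_deriv_lower_index:
  assumes "smooth_atlas A" "pseudo_riemannian_metric A g" "levi_civita A g D" "endo_field A T"
    and "vector_field A X" "vector_field A Y" "vector_field A Z"
  shows "cov_deriv_bilinear D X (\<lambda>Y Z. g (T Y) Z) Y Z p = g (cov_deriv_endo D X T Y) Z p"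
proof -
  note D = levi_civita_vector_field[OF assms(3)]
  have T: "vector_field A (T W)" if "vector_field A W" for W
    using assms(4) that by (simp add: endo_field_def)
  have "g (cov_deriv_endo D X T Y) Z = g (D X (T Y)) Z - g (T (D X Y)) Z"
    unfolding cov_deriv_endo_def
    by (rule one_form_diff[OF assms(1) metric_one_form_left[OF assms(2,7)]
          D[OF assms(5) T[OF assms(6)]] T[OF D[OF assms(5,6)]]])
  then show ?thesis
    using levi_civita_metric[OF assms(3,5) T[OF assms(6)] assms(7), of p]
    by (simp add: cov_deriv_bilinear_def apply_field_def)
qed

lemma cov_deriv_endo_vector_field:
  assumes "smooth_atlas A" "levi_civita A g D" "endo_field A T" "vector_field A X" "vector_field A Y"
  shows "vector_field A (cov_deriv_endo D X T Y)"
proof -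
  have T: "vector_field A (T W)" if "vector_field A W" for W
    using assms(3) that by (simp add: endo_field_def)
  note D = levi_civita_vector_field[OF assms(2,4)]
  show ?thesis
    unfolding cov_deriv_endo_def
    by (rule vector_field_diff[OF assms(1) D[OF T[OF assms(5)]] T[OF D[OF assms(5)]]])
qed

section \<open>Almost paracontact metric structures\<close>

lemma almost_paracontactD:
  assumes "almost_paracontact_metric A \<phi> \<xi> \<eta> g \<epsilon>"
  shows "endo_field A \<phi>" "vector_field A \<xi>" "one_form A \<eta>" "pseudo_riemannian_metric A g"
    "\<epsilon> * \<epsilon> = 1" "\<eta> \<xi> p = 1" "\<phi> \<xi> = 0"
  using assms by (auto simp: almost_paracontact_metric_def)

lemma almost_paracontact_metric_cond:
  assumes "almost_paracontact_metric A \<phi> \<xi> \<eta> g \<epsilon>" "vector_field A X" "vector_field A Y"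
  shows "g (\<phi> X) (\<phi> Y) p = g X Y p - \<epsilon> * \<eta> X p * \<eta> Y p"
  by (rule assms(1)[unfolded almost_paracontact_metric_def, THEN conjunct2, THEN conjunct2,
        THEN conjunct2, THEN conjunct2, THEN conjunct2, THEN conjunct2, THEN conjunct2,
        THEN conjunct2, THEN conjunct2, rule_format, OF assms(2,3)])

text \<open>The form \<open>\<eta>\<close> is \<open>\<epsilon>\<close> times the metric dual of \<open>\<xi>\<close>: the metric condition for the pair \<open>(X, \<xi>)\<close>
  reads \<open>0 = g(X,\<xi>) - \<epsilon> \<eta>(X)\<close>.\<close>

lemma metric_reeb:
  assumes "almost_paracontact_metric A \<phi> \<xi> \<eta> g \<epsilon>" "vector_field A X"
  shows "g X \<xi> p = \<epsilon> * \<eta> X p"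
proof -
  note ap = almost_paracontactD[OF assms(1)]
  have "vector_field A (\<phi> X)" using ap(1) assms(2) by (simp add: endo_field_def)
  then have "g (\<phi> X) (\<phi> \<xi>) = 0"
    unfolding ap(7) by (rule one_form_zero[OF metric_one_form_right[OF ap(4)]])
  moreover have "g (\<phi> X) (\<phi> \<xi>) p = g X \<xi> p - \<epsilon> * \<eta> X p * \<eta> \<xi> p"
    by (rule almost_paracontact_metric_cond[OF assms ap(2)])
  ultimately show ?thesis by (simp add: ap(6))
qed

lemma cov_deriv_reeb_form:
  assumes "almost_paracontact_metric A \<phi> \<xi> \<eta> g \<epsilon>" "levi_civita A g D"
    and "vector_field A V" "D V \<xi> = 0" "vector_field A X"
  shows "cov_deriv_form D V \<eta> X = 0"
proof
  fix p
  note ap = almost_paracontactD[OF assms(1)]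
  have dual: "\<eta> Y q = \<epsilon> * g Y \<xi> q" if "vector_field A Y" for Y q
    using metric_reeb[OF assms(1) that, of q] ap(5) by (simp flip: mult.assoc)
  have "\<eta> X = (\<lambda>q. \<epsilon> * g X \<xi> q)"
    using dual[OF assms(5)] by auto
  then have "V p (\<eta> X) = \<epsilon> * V p (g X \<xi>)"
    using field_cmult[OF assms(3) metric_smooth[OF ap(4) assms(5) ap(2)]] by simp
  also have "V p (g X \<xi>) = g (D V X) \<xi> p"
    using levi_civita_metric[OF assms(2,3,5) ap(2), of p] assms(4)
      one_form_zero[OF metric_one_form_right[OF ap(4) assms(5)]] by simp
  also have "\<epsilon> * g (D V X) \<xi> p = \<eta> (D V X) p"
    using dual levi_civita_vector_field[OF assms(2,3,5)] by simp
  finally show "cov_deriv_form D V \<eta> X p = 0 p"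
    by (simp add: cov_deriv_form_def apply_field_def)
qed

text \<open>Both summands of the para Sasakian formula for \<open>\<nabla>\<^sub>\<xi>\<phi>\<close> contain \<open>\<phi> \<xi> = 0\<close>.\<close>

lemma para_sasakian_cov_deriv_reeb:
  assumes "almost_paracontact_metric A \<phi> \<xi> \<eta> g \<epsilon>" "para_sasakian A \<phi> \<xi> \<eta> g \<epsilon> D"
    and "vector_field A Y"
  shows "cov_deriv_endo D \<xi> \<phi> Y = 0"
proof -
  note ap = almost_paracontactD[OF assms(1)]
  have "vector_field A (\<phi> Y)" using ap(1) assms(3) by (simp add: endo_field_def)
  then have "g (\<phi> \<xi>) (\<phi> Y) = 0"
    unfolding ap(7) by (rule one_form_zero[OF metric_one_form_left[OF ap(4)]])
  moreover have "\<phi> (\<phi> \<xi>) = 0"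
    using ap(7) endo_field_zero[OF ap(1)] by simp
  moreover have "cov_deriv_endo D \<xi> \<phi> Y =
      - (g (\<phi> \<xi>) (\<phi> Y) \<cdot> \<xi>) - (\<lambda>p. \<epsilon> * \<eta> Y p) \<cdot> \<phi> (\<phi> \<xi>)"
    using assms ap(2) by (simp add: para_sasakian_def)
  ultimately show ?thesis
    by (auto simp: fun_eq_iff scale_field_def scale_tangent_def)
qed

section \<open>Eta-Ricci solitons\<close>

text \<open>
  Because \<open>\<xi>\<close> has constant length and \<open>\<phi>\<xi> = 0\<close>, the soliton equation at \<open>(\<xi>, Y)\<close> reduces to
  \<open>1/2 g(\<nabla>\<^sub>\<xi>\<xi>,Y) + (\<epsilon>(a + \<lambda>) + c + \<mu>) \<eta>(Y) = 0\<close>.  At \<open>Y = \<xi>\<close> only the scalar is left; once it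
  is known to vanish, so does \<open>g(\<nabla>\<^sub>\<xi>\<xi>,Y)\<close> for every \<open>Y\<close>.
\<close>

lemma geodesic_of_soliton:
  assumes "smooth_atlas A" "almost_paracontact_metric A \<phi> \<xi> \<eta> g \<epsilon>" "levi_civita A g D"
    and "einstein_like A \<phi> \<eta> g D a b c" "eta_ricci_soliton A \<xi> \<eta> g D lam \<mu>"
  shows "\<epsilon> * (a + lam) + c + \<mu> = 0" "D \<xi> \<xi> = 0"
proof -
  note ap = almost_paracontactD[OF assms(2)]
  note D = levi_civita_vector_field[OF assms(3)]
  have unit: "g (D X \<xi>) \<xi> p = 0" if "vector_field A X" for X p
    using levi_civita_constant_length[OF ap(4) assms(3) that ap(2), of \<epsilon>]
      metric_reeb[OF assms(2) ap(2)] ap(6) by simp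
  have eq: "1 / 2 * g (D \<xi> \<xi>) Y p + (\<epsilon> * (a + lam) + c + \<mu>) * \<eta> Y p = 0"
    if Y: "vector_field A Y" for Y p
  proof -
    have "g (\<phi> \<xi>) Y = 0"
      unfolding ap(7) by (rule one_form_zero[OF metric_one_form_left[OF ap(4) Y]])
    moreover have "g \<xi> (D Y \<xi>) p = 0"
      using unit[OF Y] metric_sym[OF ap(4,2) D[OF Y ap(2)]] by simp
    moreover have "g \<xi> Y p = \<epsilon> * \<eta> Y p"
      using metric_reeb[OF assms(2) Y] metric_sym[OF ap(4,2) Y] by simp
    moreover have "1 / 2 * lie_deriv_bilinear \<xi> g \<xi> Y p + ricci A D \<xi> Y p
        + lam * g \<xi> Y p + \<mu> * \<eta> \<xi> p * \<eta> Y p = 0"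
      using assms(5) ap(2) Y by (simp add: eta_ricci_soliton_def)
    moreover have "ricci A D \<xi> Y p = a * g \<xi> Y p + b * g (\<phi> \<xi>) Y p + c * \<eta> \<xi> p * \<eta> Y p"
      using assms(4) ap(2) Y by (simp add: einstein_like_def)
    ultimately show ?thesis
      using lie_deriv_metric[OF assms(1) ap(4) assms(3) ap(2,2) Y, of p] ap(6)
      by (simp add: algebra_simps)
  qed
  show scalar: "\<epsilon> * (a + lam) + c + \<mu> = 0"
    using eq[OF ap(2)] unit[OF ap(2)] ap(6) by simp
  have "g (D \<xi> \<xi>) Y p = 0" if "vector_field A Y" for Y p
    using eq[OF that, of p] by (simp add: scalar)
  then show "D \<xi> \<xi> = 0"
    by (intro metric_nondegenerate[OF ap(4) D[OF ap(2,2)]])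
qed

text \<open>
  Along a field \<open>V\<close> for which \<open>\<xi>\<close> is parallel, the metric and \<open>\<eta>\<close> are parallel as well, so that
  differentiating \<open>a g + b g(\<phi>\<cdot>,\<cdot>) + c \<eta>\<otimes>\<eta>\<close> affects only \<open>\<phi>\<close>.
\<close>

lemma einstein_like_cov_deriv_ricci:
  assumes "smooth_atlas A" "almost_paracontact_metric A \<phi> \<xi> \<eta> g \<epsilon>" "levi_civita A g D"
    and "einstein_like A \<phi> \<eta> g D a b c" "vector_field A V" "D V \<xi> = 0"
    and Y: "vector_field A Y" and Z: "vector_field A Z"
  shows "cov_deriv_bilinear D V (ricci A D) Y Z p = b * g (cov_deriv_endo D V \<phi> Y) Z p"
proof -
  note ap = almost_paracontactD[OF assms(2)]
  note D = levi_civita_vector_field[OF assms(3,5)]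
  have \<phi>Y: "vector_field A (\<phi> Y)" using ap(1) Y by (simp add: endo_field_def)
  have ric: "ricci A D X W q = a * g X W q + (b * g (\<phi> X) W q + c * (\<eta> X q * \<eta> W q))"
    if "vector_field A X" "vector_field A W" for X W q
  proof -
    have "ricci A D X W q = a * g X W q + b * g (\<phi> X) W q + c * \<eta> X q * \<eta> W q"
      by (rule assms(4)[unfolded einstein_like_def, rule_format, OF that])
    then show ?thesis by (simp only: mult.assoc add.assoc)
  qed
  have \<eta>: "V p (\<eta> X) = \<eta> (D V X) p" if "vector_field A X" for X
    \<comment> \<open>The instantiation keeps higher-order unification from splitting \<open>D V \<xi>\<close> in other ways.\<close>
    using fun_cong[OF cov_deriv_reeb_form[where D = D and V = V and \<xi> = \<xi>,
          OF assms(2,3,5,6) that], of p]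
    by (simp add: cov_deriv_form_def apply_field_def)
  have sm: "smooth A (g Y Z)" "smooth A (g (\<phi> Y) Z)" "smooth A (\<eta> Y)" "smooth A (\<eta> Z)"
    by (rule metric_smooth[OF ap(4) Y Z] metric_smooth[OF ap(4) \<phi>Y Z]
        one_form_smooth[OF ap(3) Y] one_form_smooth[OF ap(3) Z])+
  note sm_prod = smooth_mult[OF assms(1) sm(3,4)]
  note smc = smooth_mult[OF assms(1) smooth_const]
  have "ricci A D Y Z = (\<lambda>q. a * g Y Z q + (b * g (\<phi> Y) Z q + c * (\<eta> Y q * \<eta> Z q)))"
    by (intro ext ric[OF Y Z])
  then have "V p (ricci A D Y Z) =
      a * V p (g Y Z) + (b * V p (g (\<phi> Y) Z) + c * V p (\<lambda>q. \<eta> Y q * \<eta> Z q))"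
    by (simp only: sm_prod
        field_add[OF assms(5) smc[OF sm(1)] smooth_add[OF assms(1) smc[OF sm(2)] smc[OF sm_prod]]]
        field_add[OF assms(5) smc[OF sm(2)] smc[OF sm_prod]]
        field_cmult[OF assms(5) sm(1)] field_cmult[OF assms(5) sm(2)]
        field_cmult[OF assms(5) sm_prod])
  moreover have "V p (\<lambda>q. \<eta> Y q * \<eta> Z q) = \<eta> Y p * \<eta> (D V Z) p + \<eta> Z p * \<eta> (D V Y) p"
    by (simp only: field_mult[OF assms(5) sm(3,4)] \<eta>[OF Y] \<eta>[OF Z])
  moreover have "V p (g Y Z) = g (D V Y) Z p + g Y (D V Z) p"
    by (rule levi_civita_metric[OF assms(3,5) Y Z])
  moreover have "V p (g (\<phi> Y) Z) =
      g (cov_deriv_endo D V \<phi> Y) Z p + g (\<phi> (D V Y)) Z p + g (\<phi> Y) (D V Z) p"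
    using cov_deriv_lower_index[OF assms(1) ap(4) assms(3) ap(1) assms(5) Y Z, of p]
    by (simp add: cov_deriv_bilinear_def apply_field_def)
  ultimately show ?thesis
    using ric[OF D[OF Y] Z, of p] ric[OF Y D[OF Z], of p]
    by (simp add: cov_deriv_bilinear_def apply_field_def algebra_simps)
qed

lemma cov_deriv_ricci_operator:
  assumes "smooth_atlas A" "pseudo_riemannian_metric A g" "levi_civita A g D"
    and "ricci_operator A g D Q" "vector_field A X" "vector_field A Y" "vector_field A Z"
  shows "g (cov_deriv_endo D X Q Y) Z p = cov_deriv_bilinear D X (ricci A D) Y Z p"
proof -
  have Q: "endo_field A Q"
    and low: "\<And>V W. vector_field A V \<Longrightarrow> vector_field A W \<Longrightarrow> g (Q V) W = ricci A D V W"
    using assms(4) by (auto simp: ricci_operator_def)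
  note D = levi_civita_vector_field[OF assms(3)]
  have "cov_deriv_bilinear D X (\<lambda>Y Z. g (Q Y) Z) Y Z = cov_deriv_bilinear D X (ricci A D) Y Z"
    using assms(5-7) D by (simp add: cov_deriv_bilinear_def low)
  then show ?thesis
    using cov_deriv_lower_index[OF assms(1-3) Q assms(5-7), of p] by simp
qed

theorem proposition3p3:
  fixes A :: "('m::{t2_space,second_countable_topology}, 'e::euclidean_space) chart set"
    and \<phi> :: "'m vfield \<Rightarrow> 'm vfield" and \<xi> :: "'m vfield" and \<eta> :: "'m vfield \<Rightarrow> 'm \<Rightarrow> real"
    and g :: "'m vfield \<Rightarrow> 'm vfield \<Rightarrow> 'm \<Rightarrow> real" and \<epsilon> :: real
    and D :: "'m vfield \<Rightarrow> 'm vfield \<Rightarrow> 'm vfield" and Q :: "'m vfield \<Rightarrow> 'm vfield"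
    and a b c lam \<mu> :: real
  assumes "smooth_atlas A"
    and "almost_paracontact_metric A \<phi> \<xi> \<eta> g \<epsilon>"
    and "levi_civita A g D"
    and "ricci_operator A g D Q"
    and "einstein_like A \<phi> \<eta> g D a b c"
    and "eta_ricci_soliton A \<xi> \<eta> g D lam \<mu>"
  shows "\<epsilon> * (a + lam) + c + \<mu> = 0 \<and>
         D \<xi> \<xi> = 0 \<and>
         cov_deriv_endo D \<xi> \<phi> \<xi> = 0 \<and>
         (\<forall>X. vector_field A X \<longrightarrow> cov_deriv_form D \<xi> \<eta> X = 0) \<and>
         (\<forall>Y Z. vector_field A Y \<longrightarrow> vector_field A Z \<longrightarrow>
            (\<forall>p. cov_deriv_bilinear D \<xi> (ricci A D) Y Z p = b * g (cov_deriv_endo D \<xi> \<phi> Y) Z p)) \<and>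
         (\<forall>Y. vector_field A Y \<longrightarrow>
            cov_deriv_endo D \<xi> Q Y = (\<lambda>_. b) \<cdot> cov_deriv_endo D \<xi> \<phi> Y) \<and>
         (para_sasakian A \<phi> \<xi> \<eta> g \<epsilon> D \<longrightarrow>
            (\<forall>Y Z. vector_field A Y \<longrightarrow> vector_field A Z \<longrightarrow>
               cov_deriv_bilinear D \<xi> (ricci A D) Y Z = 0) \<and>
            (\<forall>Y. vector_field A Y \<longrightarrow> cov_deriv_endo D \<xi> Q Y = 0))"
proof -
  note ap = almost_paracontactD[OF assms(2)]
  note geo = geodesic_of_soliton[OF assms(1-3,5,6)]
  have Q: "endo_field A Q" using assms(4) by (simp add: ricci_operator_def)
  have \<phi>: "cov_deriv_endo D \<xi> \<phi> \<xi> = 0"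
    using ap(7) geo(2) levi_civita_zero[OF assms(3) ap(2)] endo_field_zero[OF ap(1)]
    by (simp add: cov_deriv_endo_def)
  have \<eta>: "cov_deriv_form D \<xi> \<eta> X = 0" if "vector_field A X" for X
    by (rule cov_deriv_reeb_form[where D = D and V = \<xi> and \<xi> = \<xi>,
          OF assms(2,3) ap(2) geo(2) that])
  have S: "cov_deriv_bilinear D \<xi> (ricci A D) Y Z p = b * g (cov_deriv_endo D \<xi> \<phi> Y) Z p"
    if "vector_field A Y" "vector_field A Z" for Y Z p
    by (rule einstein_like_cov_deriv_ricci[where D = D and V = \<xi> and \<xi> = \<xi>,
          OF assms(1-3,5) ap(2) geo(2) that])
  have DQ: "cov_deriv_endo D \<xi> Q Y = (\<lambda>_. b) \<cdot> cov_deriv_endo D \<xi> \<phi> Y"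
    if Y: "vector_field A Y" for Y
  proof (rule metric_eqI[OF assms(1) ap(4)])
    have \<phi>': "vector_field A (cov_deriv_endo D \<xi> \<phi> Y)"
      by (rule cov_deriv_endo_vector_field[OF assms(1,3) ap(1,2) Y])
    show "vector_field A (cov_deriv_endo D \<xi> Q Y)"
      by (rule cov_deriv_endo_vector_field[OF assms(1,3) Q ap(2) Y])
    show "vector_field A ((\<lambda>_. b) \<cdot> cov_deriv_endo D \<xi> \<phi> Y)"
      by (rule vector_field_scale[OF assms(1) \<phi>' smooth_const])
    fix Z p
    assume Z: "vector_field A Z"
    have "g ((\<lambda>_. b) \<cdot> cov_deriv_endo D \<xi> \<phi> Y) Z = (\<lambda>_. b) * g (cov_deriv_endo D \<xi> \<phi> Y) Z"
      using metric_one_form_left[OF ap(4) Z] \<phi>' smooth_const[of A b] unfolding one_form_def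
      by blast
    then show "g (cov_deriv_endo D \<xi> Q Y) Z p = g ((\<lambda>_. b) \<cdot> cov_deriv_endo D \<xi> \<phi> Y) Z p"
      using cov_deriv_ricci_operator[OF assms(1) ap(4) assms(3,4) ap(2) Y Z] S[OF Y Z] by simp
  qed
  have sasakian: "cov_deriv_bilinear D \<xi> (ricci A D) Y Z = 0" "cov_deriv_endo D \<xi> Q Y = 0"
    if "para_sasakian A \<phi> \<xi> \<eta> g \<epsilon> D" and Y: "vector_field A Y" and Z: "vector_field A Z" for Y Z
  proof -
    note \<phi>0 = para_sasakian_cov_deriv_reeb[OF assms(2) that(1) Y]
    show "cov_deriv_bilinear D \<xi> (ricci A D) Y Z = 0"
      using S[OF Y Z] one_form_zero[OF metric_one_form_left[OF ap(4) Z]] \<phi>0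
      by (simp add: fun_eq_iff)
    show "cov_deriv_endo D \<xi> Q Y = 0"
      using DQ[OF Y] \<phi>0 by (simp add: fun_eq_iff scale_field_def scale_tangent_def)
  qed
  \<comment> \<open>The zero field serves as the idle argument \<open>Z\<close> in the claim about \<open>Q\<close>.\<close>
  show ?thesis
    using geo \<phi> \<eta> S DQ sasakian vector_field_zero by blast
qed

end
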